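(* Let $f$ be a real-valued function on the positive integers such that $$\lim_{n\to\infty}\frac{\sum_{k=1}^n a_k f(k)}{\sum_{k=1}^n b_k f(k)}=1 .$$ Then, as $p\to\infty$ through the prime numbers, $$\left|\frac{f(p)}{\sum_{k=1}^p b_k f(k)}\right|\to 0 .$$
   Context: Here $a_k=1$ if $k$ is prime and $a_k=0$ otherwise; $b_1=0$ and $b_k=\frac{1}{\ln k}$ for integers $k\ge2$. The hypothesis on the limit includes that the denominators $\sum_{k=1}^n b_k f(k)$ are nonzero for all sufficiently large $n$. *)

theory Defs
  imports Complex_Main "HOL-Computational_Algebra.Primes"
begin

definition a_coeff :: "nat \<Rightarrow> real" where
  "a_coeff k = (if prime k then 1 else 0)"

(* Only indices k >= 1 are used; the value at 0 is junk. *)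
definition b_coeff :: "nat \<Rightarrow> real" where
  "b_coeff k = (if k \<ge> 2 then 1 / ln (real k) else 0)"

end

theory Submission
  imports Defs
begin

text \<open>
  Write \<open>A n\<close> and \<open>B n\<close> for the two weighted partial sums and \<open>r n = A n / B n\<close>. At a prime \<open>p\<close> the
  sum \<open>A\<close> jumps by \<open>f p\<close>, while \<open>B\<close> jumps by only \<open>1 / ln p\<close> times that.
  Dividing both jumps by \<open>B p\<close> and putting \<open>x = f p / B p\<close> gives
  \<open>r p - r (p - 1) = x * (1 - r (p - 1) / ln p)\<close>. The left-hand side tends to \<open>0\<close> because \<open>r\<close> converges,
  and the factor on the right tends to \<open>1\<close> because \<open>r\<close> is bounded and \<open>ln p\<close> tends to infinity;
  hence \<open>x\<close> tends to \<open>0\<close>.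
\<close>

text \<open>
  Since \<open>A - y = r' * (B - y / l)\<close> with \<open>r'\<close> the earlier quotient, the jump \<open>y\<close> satisfies a linear
  equation, which is solvable as soon as \<open>r' \<noteq> l\<close>.
\<close>

lemma jump_from_quotients:
  fixes A B y l :: real
  defines "r' \<equiv> (A - y) / (B - y / l)"
  assumes "B \<noteq> 0" "B - y / l \<noteq> 0" "1 - r' / l \<noteq> 0"
  shows "y / B = (A / B - r') / (1 - r' / l)"
proof -
  have "A - y = r' * (B - y / l)"
    using assms(3) by (simp add: r'_def)
  then have "y * (1 - r' / l) = A - r' * B"
    by (simp add: algebra_simps)
  also have "\<dots> = B * (A / B - r')"
    using assms(2) by (simp add: algebra_simps)
  finally show ?thesis
    using assms(2,4) by (simp add: frac_eq_eq mult.commute)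
qed

theorem mainTheorem8:
  fixes f :: "nat \<Rightarrow> real"
  assumes denom_nonzero: "eventually (\<lambda>n. (\<Sum>k=1..n. b_coeff k * f k) \<noteq> 0) sequentially"
    and ratio_lim: "(\<lambda>n. (\<Sum>k=1..n. a_coeff k * f k) / (\<Sum>k=1..n. b_coeff k * f k)) \<longlonglongrightarrow> 1"
  shows "((\<lambda>p. \<bar>f p / (\<Sum>k=1..p. b_coeff k * f k)\<bar>) \<longlongrightarrow> 0)
           (inf sequentially (principal {p. prime p}))"
proof -
  define A where "A n = (\<Sum>k=1..n. a_coeff k * f k)" for n
  define B where "B n = (\<Sum>k=1..n. b_coeff k * f k)" for n
  define r where "r n = A n / B n" for n
  define d where "d n = 1 - r (n - 1) / ln (real n)" for n
  have pred: "filterlim (\<lambda>n::nat. n - 1) sequentially sequentially"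
    by (rule filterlim_minus_const_nat_at_top)
  have r: "r \<longlonglongrightarrow> 1"
    using ratio_lim by (simp add: r_def [abs_def] A_def B_def)
  have r': "(\<lambda>n. r (n - 1)) \<longlonglongrightarrow> 1"
    by (rule filterlim_compose [OF r pred])
  have "filterlim (\<lambda>n. ln (real n)) at_top sequentially"
    by (rule filterlim_compose [OF ln_at_top filterlim_real_sequentially])
  then have "(\<lambda>n. r (n - 1) / ln (real n)) \<longlonglongrightarrow> 0"
    by (intro tendsto_divide_0 [OF r'] filterlim_at_top_imp_at_infinity)
  then have d: "d \<longlonglongrightarrow> 1"
    unfolding d_def [abs_def] by (auto intro: tendsto_eq_intros)
  have "(\<lambda>n. (r n - r (n - 1)) / d n) \<longlonglongrightarrow> 0"
    using tendsto_divide [OF tendsto_diff [OF r r'] d] by simp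
  then have lim: "((\<lambda>n. \<bar>(r n - r (n - 1)) / d n\<bar>) \<longlongrightarrow> 0) (inf sequentially (principal {p. prime p}))"
    by (intro tendsto_rabs_zero) (rule tendsto_mono [OF inf_le1])
  have "\<forall>\<^sub>F n in sequentially. B n \<noteq> 0"
    using denom_nonzero by (simp add: B_def)
  moreover from this have "\<forall>\<^sub>F n in sequentially. B (n - 1) \<noteq> 0"
    by (rule eventually_compose_filterlim [OF _ pred])
  moreover have "\<forall>\<^sub>F n in sequentially. d n \<noteq> 0"
    by (rule tendsto_imp_eventually_ne [OF d]) simp
  ultimately have "\<forall>\<^sub>F p in sequentially. prime p \<longrightarrow> (r p - r (p - 1)) / d p = f p / B p"
  proof eventually_elim
    case (elim p)
    show ?case
    proof
      assume p: "prime p"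
      then have "p \<ge> 2"
        by (rule prime_ge_2_nat)
      then obtain m where m: "p = Suc m"
        by (cases p) auto
      have "A (p - 1) = A p - f p" "B (p - 1) = B p - f p / ln (real p)"
        using p \<open>p \<ge> 2\<close> by (simp_all add: A_def B_def m a_coeff_def b_coeff_def)
      then show "(r p - r (p - 1)) / d p = f p / B p"
        using jump_from_quotients [of "B p" "f p" "ln (real p)" "A p"] elim
        by (simp add: r_def d_def)
    qed
  qed
  then have "\<forall>\<^sub>F p in inf sequentially (principal {p. prime p}).
      \<bar>(r p - r (p - 1)) / d p\<bar> = \<bar>f p / B p\<bar>"
    unfolding eventually_inf_principal by eventually_elim auto
  from Lim_transform_eventually [OF lim this] show ?thesis
    by (simp add: B_def)
qed

end
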